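(* Let $n,k\ge2$ be integers. For each of the following six properties there is a size $m_1\times\cdots\times m_n$ such that the set of $n$-player games of this size having the property is not open in the set of all games of this size: having exactly $k$ Nash equilibria; having at most $k$ Nash equilibria; having at least $k$ Nash equilibria; the set of correlated equilibria having exactly $k$ extreme points; the set of correlated equilibria having at most $k$ extreme points; the set of correlated equilibria having at least $k$ extreme points.
   Context: A finite $n$-player game has player set $I=\{1,\dots,n\}$, finite nonempty pure strategy sets $S^i$, $S=\times_{i\in I}S^i$, $S^{-i}=\times_{j\ne i}S^j$, and utility functions $U^i:S\to\mathbb{R}$. It has size $m_1\times\cdots\times m_n$ if $|S^i|=m_i$ for all $i$. Fixing the strategy sets, such a game is identified with its payoffs, a point of $(\mathbb{R}^{m_1m_2\cdots m_n})^n$; openness refers to the usual topology of this space. Nash equilibria are taken in mixed strategies. A correlated equilibrium is a probability distribution $\mu$ on $S$ such that for all $i\in I$ and all $s^i,t^i\in S^i$, $$\sum_{s^{-i}\in S^{-i}}\mu(s^i,s^{-i})\,[U^i(s^i,s^{-i})-U^i(t^i,s^{-i})]\ge 0 .$$ The set of correlated equilibria is a polytope in $\mathbb{R}^S$. *)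

theory Defs
  imports "HOL-Analysis.Analysis" "HOL-Analysis.Finite_Function_Topology"
begin

definition profiles :: "'i set \<Rightarrow> ('i \<Rightarrow> 'a set) \<Rightarrow> ('i \<Rightarrow> 'a) set" where
  "profiles I S = Pi\<^sub>E I S"

text \<open>With the strategy sets \<open>S\<close> fixed, a game is its payoff family \<open>U i s\<close>. As elements of the
  extensional product, payoff functions carry no information outside \<open>I\<close> and \<open>profiles I S\<close>,
  so for finite \<open>I\<close> and \<open>profiles I S\<close> the product topology is the usual topology of the finite-dimensional space.\<close>

definition game_space :: "'i set \<Rightarrow> ('i \<Rightarrow> 'a set) \<Rightarrow> ('i \<Rightarrow> ('i \<Rightarrow> 'a) \<Rightarrow> real) topology" where
  "game_space I S = product_topology (\<lambda>i. product_topology (\<lambda>s. euclideanreal) (profiles I S)) I"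

text \<open>Extensionality gives each mixed strategy a unique representative, so that equilibria can be
  counted.\<close>

definition mixed_strategies :: "'a set \<Rightarrow> ('a \<Rightarrow> real) set" where
  "mixed_strategies A = {p \<in> A \<rightarrow>\<^sub>E {0..}. (\<Sum>a\<in>A. p a) = 1}"

definition expected_utility ::
  "'i set \<Rightarrow> ('i \<Rightarrow> 'a set) \<Rightarrow> (('i \<Rightarrow> 'a) \<Rightarrow> real) \<Rightarrow> ('i \<Rightarrow> 'a \<Rightarrow> real) \<Rightarrow> real" where
  "expected_utility I S u x = (\<Sum>s\<in>profiles I S. (\<Prod>j\<in>I. x j (s j)) * u s)"

definition nash_equilibria ::
  "'i set \<Rightarrow> ('i \<Rightarrow> 'a set) \<Rightarrow> ('i \<Rightarrow> ('i \<Rightarrow> 'a) \<Rightarrow> real) \<Rightarrow> ('i \<Rightarrow> 'a \<Rightarrow> real) set" where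
  "nash_equilibria I S U =
     {x \<in> Pi\<^sub>E I (\<lambda>i. mixed_strategies (S i)).
        \<forall>i\<in>I. \<forall>y\<in>mixed_strategies (S i).
          expected_utility I S (U i) (x(i := y)) \<le> expected_utility I S (U i) x}"

text \<open>Distributions are finitely supported functions with support in \<open>profiles I S\<close>, because that
  type is an instance of \<open>real_vector\<close>, which \<open>extreme_point_of\<close> requires. The profile
  \<open>(s\<^sup>i, s\<^sup>-\<^sup>i)\<close> is \<open>r(i := a)\<close> with \<open>a = s\<^sup>i\<close> and \<open>r = s\<^sup>-\<^sup>i\<close>.\<close>

definition correlated_equilibria ::
  "'i set \<Rightarrow> ('i \<Rightarrow> 'a set) \<Rightarrow> ('i \<Rightarrow> ('i \<Rightarrow> 'a) \<Rightarrow> real) \<Rightarrow> (('i \<Rightarrow> 'a) \<Rightarrow>\<^sub>0 real) set" where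
  "correlated_equilibria I S U =
     {\<mu>. Poly_Mapping.keys \<mu> \<subseteq> profiles I S \<and>
         (\<forall>s\<in>profiles I S. 0 \<le> Poly_Mapping.lookup \<mu> s) \<and>
         (\<Sum>s\<in>profiles I S. Poly_Mapping.lookup \<mu> s) = 1 \<and>
         (\<forall>i\<in>I. \<forall>a\<in>S i. \<forall>b\<in>S i.
            0 \<le> (\<Sum>r\<in>profiles (I - {i}) S.
                   Poly_Mapping.lookup \<mu> (r(i := a)) * (U i (r(i := a)) - U i (r(i := b)))))}"

definition correlated_extreme_points ::
  "'i set \<Rightarrow> ('i \<Rightarrow> 'a set) \<Rightarrow> ('i \<Rightarrow> ('i \<Rightarrow> 'a) \<Rightarrow> real) \<Rightarrow> (('i \<Rightarrow> 'a) \<Rightarrow>\<^sub>0 real) set" where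
  "correlated_extreme_points I S U = {\<mu>. \<mu> extreme_point_of correlated_equilibria I S U}"

definition exactly :: "nat \<Rightarrow> 'b set \<Rightarrow> bool" where
  "exactly k X \<longleftrightarrow> finite X \<and> card X = k"

definition at_most :: "nat \<Rightarrow> 'b set \<Rightarrow> bool" where
  "at_most k X \<longleftrightarrow> finite X \<and> card X \<le> k"

text \<open>An infinite set has \<open>card X = 0\<close> but does have at least \<open>k\<close> elements.\<close>

definition at_least :: "nat \<Rightarrow> 'b set \<Rightarrow> bool" where
  "at_least k X \<longleftrightarrow> infinite X \<or> k \<le> card X"

text \<open>The players are \<open>1, \<dots>, n\<close>, and in size \<open>m 1 \<times> \<dots> \<times> m n\<close> player \<open>i\<close> has the strategies
  \<open>1, \<dots>, m i\<close>; the values of \<open>m\<close> outside \<open>{1..n}\<close> play no role.\<close>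

definition strategy_sets :: "(nat \<Rightarrow> nat) \<Rightarrow> nat \<Rightarrow> nat set" where
  "strategy_sets m i = {1..m i}"

definition open_property ::
  "nat \<Rightarrow> (nat \<Rightarrow> nat) \<Rightarrow> ((nat \<Rightarrow> (nat \<Rightarrow> nat) \<Rightarrow> real) \<Rightarrow> bool) \<Rightarrow> bool" where
  "open_property n m P \<longleftrightarrow>
     openin (game_space {1..n} (strategy_sets m))
       {U \<in> topspace (game_space {1..n} (strategy_sets m)). P U}"

definition game_size :: "nat \<Rightarrow> (nat \<Rightarrow> nat) \<Rightarrow> bool" where
  "game_size n m \<longleftrightarrow> (\<forall>i\<in>{1..n}. 1 \<le> m i)"

end

theory Submission
  imports Defs
begin

text \<open>A mixed profile is a Nash equilibrium iff its product distribution is a correlated equilibrium,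
  so everything is read off the correlated equilibria of one \<open>k \<times> k \<times> 1 \<times> \<dots> \<times> 1\<close> game: player 1
  gets 1 if \<open>s\<^sub>1 \<le> s\<^sub>2\<close>, player 2 gets 1 if \<open>s\<^sub>2 \<le> s\<^sub>1\<close>, and all other payoffs are 0. Strategy 1 is weakly
  dominant for both players, which forces correlated equilibria onto the diagonal; all diagonal
  distributions qualify, giving exactly \<open>k\<close> Nash equilibria and \<open>k\<close> extreme points. A bonus
  \<open>\<epsilon> > 0\<close> for strategy 1 makes it strictly dominant and leaves one equilibrium. A bonus \<open>\<eta> > 0\<close>
  for player 2 at \<open>(k, k)\<close> keeps the old extreme points, but now player 1, who is indifferent against
  \<open>k\<close>, may shift some weight from \<open>k\<close> to 1: this yields a continuum of Nash equilibria and, at the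
  largest possible weight \<open>\<eta> / (1 + \<eta>)\<close>, a new extreme point.\<close>

section \<open>Best replies and correlated equilibria\<close>

text \<open>Restricted to \<open>A\<close> because \<open>mixed_strategies\<close> admits only
  extensional functions.\<close>

definition pure_strategy :: "'a set \<Rightarrow> 'a \<Rightarrow> 'a \<Rightarrow> real" where
  "pure_strategy A a = (\<lambda>c\<in>A. of_bool (c = a))"

lemma pure_strategy_mixed:
  assumes "finite A" "a \<in> A"
  shows "pure_strategy A a \<in> mixed_strategies A"
  using assms by (auto simp: mixed_strategies_def pure_strategy_def)

lemma sum_pure_strategy:
  assumes "finite A" "a \<in> A"
  shows "(\<Sum>c\<in>A. pure_strategy A a c * W c) = W a"
proof -
  have "(\<Sum>c\<in>A. pure_strategy A a c * W c) = (\<Sum>c\<in>A. if c = a then W c else 0)"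
    by (rule sum.cong) (auto simp: pure_strategy_def)
  then show ?thesis using assms by simp
qed

text \<open>\<open>?V\<close> is the average of \<open>W\<close> with weights \<open>p\<close>.
  Optimality says that no \<open>W b\<close> exceeds it, which forces \<open>W a = ?V\<close>
  wherever \<open>p a > 0\<close>. The pairwise form on the right has the shape of the incentive
  constraints of a correlated equilibrium.\<close>

lemma mixed_optimal_iff:
  fixes W :: "'a \<Rightarrow> real"
  assumes "finite A" and p: "p \<in> mixed_strategies A"
  shows "(\<forall>y\<in>mixed_strategies A. (\<Sum>a\<in>A. y a * W a) \<le> (\<Sum>a\<in>A. p a * W a)) \<longleftrightarrow>
         (\<forall>a\<in>A. \<forall>b\<in>A. 0 \<le> p a * (W a - W b))" (is "?L \<longleftrightarrow> ?R")
proof -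
  let ?V = "\<Sum>a\<in>A. p a * W a"
  have p0: "0 \<le> p a" if "a \<in> A" for a
    using p that by (auto simp: mixed_strategies_def)
  have p1: "(\<Sum>a\<in>A. p a) = 1"
    using p by (auto simp: mixed_strategies_def)
  show ?thesis
  proof
    assume L: ?L
    have le: "W b \<le> ?V" if "b \<in> A" for b
      using L pure_strategy_mixed[OF assms(1) that] sum_pure_strategy[OF assms(1) that, of W]
      by auto
    \<comment> \<open>The deviations from the mean average to 0; being nonnegative by
      \<open>le\<close>, they vanish one by one.\<close>
    have "(\<Sum>a\<in>A. p a * (?V - W a)) = (\<Sum>a\<in>A. p a) * ?V - ?V"
      by (simp add: algebra_simps sum_subtractf sum_distrib_right)
    then have "(\<Sum>a\<in>A. p a * (?V - W a)) = 0"
      using p1 by simp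
    then have z: "p a * (?V - W a) = 0" if "a \<in> A" for a
      using that p0 le assms(1) by (subst (asm) sum_nonneg_eq_0_iff) auto
    show ?R
    proof (intro ballI)
      fix a b assume ab: "a \<in> A" "b \<in> A"
      have "p a * (W a - W b) = p a * (?V - W b)"
        using z[OF ab(1)] by (auto simp: right_diff_distrib)
      also have "0 \<le> \<dots>"
        using p0[OF ab(1)] le[OF ab(2)] by simp
      finally show "0 \<le> p a * (W a - W b)" .
    qed
  next
    assume R: ?R
    have le: "W b \<le> ?V" if "b \<in> A" for b
    proof -
      \<comment> \<open>Summing the pairwise inequalities over \<open>a\<close> compares
        \<open>W b\<close> with the mean.\<close>
      have "W b = (\<Sum>a\<in>A. p a * W b)"
        using p1 by (simp flip: sum_distrib_right)
      also have "\<dots> \<le> ?V"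
        using R that by (intro sum_mono) (auto simp: algebra_simps)
      finally show ?thesis .
    qed
    show ?L
    proof
      fix y assume y: "y \<in> mixed_strategies A"
      have "(\<Sum>a\<in>A. y a * W a) \<le> (\<Sum>a\<in>A. y a * ?V)"
        using y le by (intro sum_mono mult_left_mono) (auto simp: mixed_strategies_def)
      also have "\<dots> = ?V"
        using y by (simp add: mixed_strategies_def flip: sum_distrib_right)
      finally show "(\<Sum>a\<in>A. y a * W a) \<le> ?V" .
    qed
  qed
qed

section \<open>Splitting profiles by the strategy of one player\<close>

lemma profiles_upd:
  assumes "s \<in> profiles I S" "i \<in> I" "a \<in> S i"
  shows "s(i := a) \<in> profiles I S"
  using assms by (auto simp: profiles_def PiE_def Pi_def extensional_def)

text \<open>In an extensional product, forgetting the entry of player \<open>i\<close> means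
  resetting it to \<open>undefined\<close>; this is the inverse map.\<close>

lemma bij_betw_profiles_fiber:
  assumes "i \<in> I" "a \<in> S i"
  shows "bij_betw (\<lambda>r. r(i := a)) (profiles (I - {i}) S) {s \<in> profiles I S. s i = a}"
proof (rule bij_betw_byWitness[where f' = "\<lambda>s. s(i := undefined)"])
  show "\<forall>r\<in>profiles (I - {i}) S. (r(i := a))(i := undefined) = r"
    by (auto simp: profiles_def PiE_def extensional_def)
  show "\<forall>s\<in>{s \<in> profiles I S. s i = a}. (s(i := undefined))(i := a) = s"
    by auto
  show "(\<lambda>r. r(i := a)) ` profiles (I - {i}) S \<subseteq> {s \<in> profiles I S. s i = a}"
    using assms by (auto simp: profiles_def PiE_def extensional_def Pi_def)
  show "(\<lambda>s. s(i := undefined)) ` {s \<in> profiles I S. s i = a} \<subseteq> profiles (I - {i}) S"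
    by (auto simp: profiles_def PiE_def extensional_def Pi_def)
qed

lemma sum_profiles_fiber:
  assumes "i \<in> I" "a \<in> S i"
  shows "(\<Sum>r\<in>profiles (I - {i}) S. g (r(i := a))) = (\<Sum>s | s \<in> profiles I S \<and> s i = a. g s)"
  using sum.reindex_bij_betw[OF bij_betw_profiles_fiber[where S = S, OF assms], of g] by simp

text \<open>Summing over full profiles with entry \<open>a\<close> for player \<open>i\<close>,
  instead of over opponents' profiles, lets each constraint be examined term by term on the support
  of \<open>\<mu>\<close>.\<close>

lemma correlated_equilibria_iff:
  "\<mu> \<in> correlated_equilibria I S U \<longleftrightarrow>
     Poly_Mapping.keys \<mu> \<subseteq> profiles I S \<and>
     (\<forall>s\<in>profiles I S. 0 \<le> Poly_Mapping.lookup \<mu> s) \<and>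
     (\<Sum>s\<in>profiles I S. Poly_Mapping.lookup \<mu> s) = 1 \<and>
     (\<forall>i\<in>I. \<forall>a\<in>S i. \<forall>b\<in>S i.
        0 \<le> (\<Sum>s | s \<in> profiles I S \<and> s i = a.
               Poly_Mapping.lookup \<mu> s * (U i s - U i (s(i := b)))))"
proof -
  have "(\<Sum>r\<in>profiles (I - {i}) S.
           Poly_Mapping.lookup \<mu> (r(i := a)) * (U i (r(i := a)) - U i (r(i := b)))) =
        (\<Sum>s | s \<in> profiles I S \<and> s i = a.
           Poly_Mapping.lookup \<mu> s * (U i s - U i (s(i := b))))"
    if "i \<in> I" "a \<in> S i" for i a b
    using sum_profiles_fiber[where S = S, OF that,
        of "\<lambda>s. Poly_Mapping.lookup \<mu> s * (U i s - U i (s(i := b)))"] by simp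
  then show ?thesis
    unfolding correlated_equilibria_def by simp
qed

section \<open>The simplex of distributions on a finite set and its vertices\<close>

definition distributions_on :: "'b set \<Rightarrow> ('b \<Rightarrow>\<^sub>0 real) set" where
  "distributions_on F =
     {\<mu>. Poly_Mapping.keys \<mu> \<subseteq> F \<and> (\<forall>s\<in>F. 0 \<le> Poly_Mapping.lookup \<mu> s) \<and>
         (\<Sum>s\<in>F. Poly_Mapping.lookup \<mu> s) = 1}"

lemma distributions_on_nonneg:
  "\<mu> \<in> distributions_on F \<Longrightarrow> 0 \<le> Poly_Mapping.lookup \<mu> s"
  by (cases "Poly_Mapping.lookup \<mu> s = 0") (auto simp: distributions_on_def in_keys_iff subset_iff)

text \<open>Scalar multiplication is defined through \<open>Abs_poly_mapping\<close>, so the support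
  must be shown finite before the abstraction can be unfolded.\<close>

lemma lookup_scaleR [simp]:
  "Poly_Mapping.lookup (c *\<^sub>R \<mu>) s = c * Poly_Mapping.lookup \<mu> s"
proof -
  have "finite {s. Poly_Mapping.lookup \<mu> s \<noteq> 0}"
    using finite_lookup .
  then have "finite {s. c *\<^sub>R Poly_Mapping.lookup \<mu> s \<noteq> 0}"
    by (rule finite_subset[rotated]) auto
  then show ?thesis
    by (simp add: scaleR_poly_mapping_def)
qed

lemma distributions_on_subset_iff:
  assumes "finite G" "F \<subseteq> G"
  shows "\<mu> \<in> distributions_on F \<longleftrightarrow> \<mu> \<in> distributions_on G \<and> Poly_Mapping.keys \<mu> \<subseteq> F"
proof -
  have *: "(\<Sum>s\<in>F. Poly_Mapping.lookup \<mu> s) = (\<Sum>s\<in>G. Poly_Mapping.lookup \<mu> s)"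
    if "Poly_Mapping.keys \<mu> \<subseteq> F"
    using assms that by (intro sum.mono_neutral_left) (auto simp: in_keys_iff)
  have "\<mu> \<in> distributions_on F \<Longrightarrow> \<forall>s\<in>G. 0 \<le> Poly_Mapping.lookup \<mu> s"
    by (simp add: distributions_on_nonneg)
  then show ?thesis
    using assms * unfolding distributions_on_def mem_Collect_eq by (metis subset_iff)
qed

lemma lookup_single_if: "Poly_Mapping.lookup (Poly_Mapping.single s c) t = (if t = s then c else 0)"
  by (simp add: lookup_single when_def)

lemma single_in_distributions_on:
  assumes "finite F" "s \<in> F"
  shows "Poly_Mapping.single s 1 \<in> distributions_on F"
  using assms unfolding distributions_on_def mem_Collect_eq by (simp add: lookup_single_if)

lemma distributions_on_singleton: "distributions_on {s} = {Poly_Mapping.single s 1}"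
proof -
  have "\<mu> = Poly_Mapping.single s 1" if "\<mu> \<in> distributions_on {s}" for \<mu>
  proof (rule poly_mapping_eqI)
    fix t
    have "Poly_Mapping.lookup \<mu> s = 1" "t \<noteq> s \<Longrightarrow> Poly_Mapping.lookup \<mu> t = 0"
      using that by (auto simp: distributions_on_def in_keys_iff)
    then show "Poly_Mapping.lookup \<mu> t = Poly_Mapping.lookup (Poly_Mapping.single s 1) t"
      by (simp add: lookup_single_if)
  qed
  then show ?thesis
    using single_in_distributions_on[of "{s}" s] by blast
qed

text \<open>A convex combination of nonnegative numbers with both weights positive is 0 only if both
  numbers are 0. So the distributions with support in a fixed set form a face.\<close>

lemma keys_open_segment:
  assumes "\<mu> \<in> open_segment a b" "a \<in> distributions_on G" "b \<in> distributions_on G"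
  shows "Poly_Mapping.keys a \<subseteq> Poly_Mapping.keys \<mu>" "Poly_Mapping.keys b \<subseteq> Poly_Mapping.keys \<mu>"
proof -
  obtain u where u: "0 < u" "u < 1" "\<mu> = (1 - u) *\<^sub>R a + u *\<^sub>R b"
    using assms(1) by (auto simp: in_segment)
  have "Poly_Mapping.lookup a s = 0 \<and> Poly_Mapping.lookup b s = 0"
    if "Poly_Mapping.lookup \<mu> s = 0" for s
    using that u distributions_on_nonneg[OF assms(2), of s] distributions_on_nonneg[OF assms(3), of s]
    by (simp add: lookup_add add_nonneg_eq_0_iff)
  then show "Poly_Mapping.keys a \<subseteq> Poly_Mapping.keys \<mu>" "Poly_Mapping.keys b \<subseteq> Poly_Mapping.keys \<mu>"
    by (auto simp: in_keys_iff)
qed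

text \<open>Both ends of an open segment through a point mass are supported on the same point, hence
  equal, and then the open segment is empty.\<close>

lemma single_extreme_point:
  assumes "finite G" "C \<subseteq> distributions_on G" "Poly_Mapping.single s 1 \<in> C"
  shows "Poly_Mapping.single s 1 extreme_point_of C"
proof -
  have "Poly_Mapping.single s 1 \<notin> open_segment a b" if "a \<in> C" "b \<in> C" for a b
  proof
    assume seg: "Poly_Mapping.single s 1 \<in> open_segment a b"
    have s: "s \<in> G"
      using assms(2,3) by (auto simp: distributions_on_def)
    have "a \<in> distributions_on {s}" "b \<in> distributions_on {s}"
      using keys_open_segment[OF seg, of G] that assms s
      by (auto simp: distributions_on_subset_iff[of G "{s}"] split: if_splits)
    then show False
      using seg by (auto simp: distributions_on_singleton)
  qed
  then show ?thesis
    using assms(3) by (auto simp: extreme_point_of_def)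
qed

text \<open>For the direction from left to right, a distribution with a weight strictly between 0
  and 1 at \<open>s\<close> splits into the point mass at \<open>s\<close> and its renormalised
  remainder, so it is not extreme.\<close>

lemma extreme_points_distributions_on:
  assumes "finite F"
  shows "{\<mu>. \<mu> extreme_point_of distributions_on F} = (\<lambda>s. Poly_Mapping.single s 1) ` F"
proof (intro equalityI subsetI)
  fix \<mu> :: "'a \<Rightarrow>\<^sub>0 real"
  assume "\<mu> \<in> (\<lambda>s. Poly_Mapping.single s 1) ` F"
  then show "\<mu> \<in> {\<mu>. \<mu> extreme_point_of distributions_on F}"
    using assms by (auto intro!: single_extreme_point[of F] single_in_distributions_on)
next
  fix \<mu> :: "'a \<Rightarrow>\<^sub>0 real"
  assume "\<mu> \<in> {\<mu>. \<mu> extreme_point_of distributions_on F}"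
  then have ext: "\<mu> \<in> distributions_on F"
      "\<And>a b. a \<in> distributions_on F \<Longrightarrow> b \<in> distributions_on F \<Longrightarrow> \<mu> \<notin> open_segment a b"
    by (auto simp: extreme_point_of_def)
  have sum1: "(\<Sum>s\<in>F. Poly_Mapping.lookup \<mu> s) = 1"
    using ext(1) by (simp add: distributions_on_def)
  then obtain s where s: "s \<in> F" "Poly_Mapping.lookup \<mu> s \<noteq> 0"
    by (metis sum.neutral zero_neq_one)
  define c where "c = Poly_Mapping.lookup \<mu> s"
  have c0: "0 < c"
    using s distributions_on_nonneg[OF ext(1), of s] by (simp add: c_def)
  have rest: "(\<Sum>t\<in>F - {s}. Poly_Mapping.lookup \<mu> t) = 1 - c"
    using sum.remove[OF assms s(1), of "Poly_Mapping.lookup \<mu>"] sum1 by (simp add: c_def)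
  have c1: "c \<le> 1"
    using rest sum_nonneg[of "F - {s}" "Poly_Mapping.lookup \<mu>"] distributions_on_nonneg[OF ext(1)]
    by simp
  have "c = 1"
  proof (rule ccontr)
    assume "c \<noteq> 1"
    then have c1: "c < 1" using c1 by simp
    \<comment> \<open>\<open>\<nu>\<close> is \<open>\<mu>\<close> conditioned on avoiding
      \<open>s\<close>; it vanishes at \<open>s\<close> and so differs from the point mass
      there.\<close>
    define \<nu> where "\<nu> = (1 / (1 - c)) *\<^sub>R (\<mu> - c *\<^sub>R Poly_Mapping.single s 1)"
    have lookup_\<nu>: "Poly_Mapping.lookup \<nu> t = (if t = s then 0 else Poly_Mapping.lookup \<mu> t / (1 - c))" for t
      by (auto simp: \<nu>_def lookup_minus lookup_single_if c_def)
    have "(\<Sum>t\<in>F. Poly_Mapping.lookup \<nu> t) = (\<Sum>t\<in>F - {s}. Poly_Mapping.lookup \<mu> t) / (1 - c)"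
      using sum.remove[OF assms s(1), of "Poly_Mapping.lookup \<nu>"]
      by (simp add: lookup_\<nu> sum_divide_distrib)
    then have "\<nu> \<in> distributions_on F"
      using ext(1) c1 rest distributions_on_nonneg[OF ext(1)]
      by (auto simp: distributions_on_def lookup_\<nu> in_keys_iff subset_iff)
    moreover have "\<mu> \<in> open_segment \<nu> (Poly_Mapping.single s 1)"
    proof -
      have "\<nu> \<noteq> Poly_Mapping.single s 1"
        using lookup_\<nu>[of s] by auto
      moreover have "\<mu> = (1 - c) *\<^sub>R \<nu> + c *\<^sub>R Poly_Mapping.single s 1"
        using c1 by (simp add: \<nu>_def)
      ultimately show ?thesis
        using c0 c1 by (auto simp: in_segment)
    qed
    ultimately show False
      using ext(2) single_in_distributions_on[OF assms s(1)] by blast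
  qed
  then have "Poly_Mapping.lookup \<mu> t = 0" if "t \<in> F - {s}" for t
    using rest that assms distributions_on_nonneg[OF ext(1)]
    by (simp add: sum_nonneg_eq_0_iff)
  then have "Poly_Mapping.keys \<mu> \<subseteq> {s}"
    using ext(1) by (auto simp: distributions_on_def in_keys_iff)
  then have "\<mu> \<in> distributions_on {s}"
    using ext(1) assms s by (simp add: distributions_on_subset_iff[of F "{s}"])
  then show "\<mu> \<in> (\<lambda>s. Poly_Mapping.single s 1) ` F"
    using s by (auto simp: distributions_on_singleton)
qed

section \<open>Product distributions\<close>

locale finite_game =
  fixes I :: "'i set" and S :: "'i \<Rightarrow> 'a set"
  assumes finite_players: "finite I"
    and finite_strategies: "i \<in> I \<Longrightarrow> finite (S i)"
begin

lemma finite_profiles: "finite (profiles I S)"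
  unfolding profiles_def by (rule finite_PiE[OF finite_players finite_strategies])

text \<open>The cut-off at \<open>profiles I S\<close> matters: the product over \<open>I\<close>
  ignores coordinates outside \<open>I\<close>, so non-extensional functions could carry weight too
  and the support need not be finite.\<close>

definition product_distribution :: "('i \<Rightarrow> 'a \<Rightarrow> real) \<Rightarrow> (('i \<Rightarrow> 'a) \<Rightarrow>\<^sub>0 real)" where
  "product_distribution x =
     Abs_poly_mapping (\<lambda>s. if s \<in> profiles I S then \<Prod>j\<in>I. x j (s j) else 0)"

lemma lookup_product_distribution:
  "Poly_Mapping.lookup (product_distribution x) s =
     (if s \<in> profiles I S then \<Prod>j\<in>I. x j (s j) else 0)"
proof -
  have "finite {s. (if s \<in> profiles I S then \<Prod>j\<in>I. x j (s j) else 0) \<noteq> 0}"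
    by (rule finite_subset[OF _ finite_profiles]) auto
  then show ?thesis
    by (simp add: product_distribution_def)
qed

lemma product_distribution_on:
  assumes "x \<in> Pi\<^sub>E I (\<lambda>i. mixed_strategies (S i))"
  shows "product_distribution x \<in> distributions_on (profiles I S)"
proof -
  have "(\<Sum>s\<in>profiles I S. \<Prod>j\<in>I. x j (s j)) = (\<Prod>j\<in>I. \<Sum>a\<in>S j. x j a)"
    unfolding profiles_def
    using finite_players finite_strategies by (subst prod_sum_PiE) auto
  also have "\<dots> = 1"
    using assms by (intro prod.neutral) (auto simp: mixed_strategies_def PiE_def Pi_def)
  finally show ?thesis
    using assms
    by (auto simp: distributions_on_def in_keys_iff lookup_product_distribution mixed_strategies_def
        profiles_def PiE_def Pi_def intro!: prod_nonneg split: if_splits)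
qed

text \<open>The expected payoff of the pure reply \<open>a\<close> when the others play according to
  \<open>x\<close>. It is independent of \<open>x i\<close>, so these values are the coefficients of
  a linear function of player \<open>i\<close>'s own strategy.\<close>

definition reply_value ::
  "(('i \<Rightarrow> 'a) \<Rightarrow> real) \<Rightarrow> 'i \<Rightarrow> ('i \<Rightarrow> 'a \<Rightarrow> real) \<Rightarrow> 'a \<Rightarrow> real" where
  "reply_value u i x a =
     (\<Sum>r\<in>profiles (I - {i}) S. (\<Prod>j\<in>I - {i}. x j (r j)) * u (r(i := a)))"

lemma prod_profile_upd:
  assumes "i \<in> I"
  shows "(\<Prod>j\<in>I. x j ((r(i := a)) j)) = x i a * (\<Prod>j\<in>I - {i}. x j (r j))"
  using assms finite_players by (subst prod.remove[of _ i]) (auto intro!: prod.cong)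

lemma expected_utility_upd:
  assumes "i \<in> I"
  shows "expected_utility I S (U i) (x(i := y)) = (\<Sum>a\<in>S i. y a * reply_value (U i) i x a)"
proof -
  let ?g = "\<lambda>s. (\<Prod>j\<in>I. (x(i := y)) j (s j)) * U i s"
  have "expected_utility I S (U i) (x(i := y)) = (\<Sum>a\<in>S i. \<Sum>s | s \<in> profiles I S \<and> s i = a. ?g s)"
    \<comment> \<open>Profiles are grouped by the strategy of player \<open>i\<close>.\<close>
    unfolding expected_utility_def using assms finite_strategies
    by (subst sum.group[OF finite_profiles, of "S i" "\<lambda>s. s i"]) (auto simp: profiles_def)
  also have "\<dots> = (\<Sum>a\<in>S i. y a * reply_value (U i) i x a)"
  proof (rule sum.cong)
    fix a assume "a \<in> S i"
    then have "(\<Sum>s | s \<in> profiles I S \<and> s i = a. ?g s) =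
        (\<Sum>r\<in>profiles (I - {i}) S. ?g (r(i := a)))"
      by (intro sum_profiles_fiber[symmetric] assms)
    also have "\<dots> = (\<Sum>r\<in>profiles (I - {i}) S. y a * ((\<Prod>j\<in>I - {i}. x j (r j)) * U i (r(i := a))))"
    proof (rule sum.cong)
      fix r
      show "?g (r(i := a)) = y a * ((\<Prod>j\<in>I - {i}. x j (r j)) * U i (r(i := a)))"
        by (subst prod_profile_upd[OF assms]) (auto intro!: prod.cong)
    qed simp
    finally show "(\<Sum>s | s \<in> profiles I S \<and> s i = a. ?g s) = y a * reply_value (U i) i x a"
      by (simp add: reply_value_def sum_distrib_left)
  qed simp
  finally show ?thesis .
qed

text \<open>Under a product distribution, the recommendation \<open>a\<close> tells player
  \<open>i\<close> nothing about the others. The incentive constraint therefore factors into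
  \<open>x i a\<close> times a difference of reply values, which is the criterion of
  \<open>mixed_optimal_iff\<close>.\<close>

lemma nash_iff_product_correlated:
  assumes x: "x \<in> Pi\<^sub>E I (\<lambda>i. mixed_strategies (S i))"
  shows "x \<in> nash_equilibria I S U \<longleftrightarrow> product_distribution x \<in> correlated_equilibria I S U"
proof -
  have C: "(\<Sum>r\<in>profiles (I - {i}) S. Poly_Mapping.lookup (product_distribution x) (r(i := a)) *
             (U i (r(i := a)) - U i (r(i := b)))) = x i a * (reply_value (U i) i x a - reply_value (U i) i x b)"
    if i: "i \<in> I" and a: "a \<in> S i" for i a b
  proof -
    have "Poly_Mapping.lookup (product_distribution x) (r(i := a)) =
        x i a * (\<Prod>j\<in>I - {i}. x j (r j))"
      if "r \<in> profiles (I - {i}) S" for r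
      using that bij_betwE[OF bij_betw_profiles_fiber[where S = S, OF i a]] prod_profile_upd[OF i, of x r a]
      by (auto simp: lookup_product_distribution)
    then show ?thesis
      by (simp add: reply_value_def sum_distrib_left algebra_simps sum_subtractf)
  qed
  have N: "expected_utility I S (U i) x = (\<Sum>a\<in>S i. x i a * reply_value (U i) i x a)" if "i \<in> I" for i
    using expected_utility_upd[OF that, where x = x and y = "x i"] by simp
  have "x \<in> nash_equilibria I S U \<longleftrightarrow>
      (\<forall>i\<in>I. \<forall>a\<in>S i. \<forall>b\<in>S i. 0 \<le> x i a * (reply_value (U i) i x a - reply_value (U i) i x b))"
    unfolding nash_equilibria_def
    using x by (simp add: expected_utility_upd N mixed_optimal_iff[OF finite_strategies PiE_mem[OF x]])
  also have "\<dots> \<longleftrightarrow> product_distribution x \<in> correlated_equilibria I S U"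
    using product_distribution_on[OF x]
    by (auto simp: correlated_equilibria_def distributions_on_def C)
  finally show ?thesis .
qed


section \<open>Bounding correlated equilibria by dominance and by pure equilibria\<close>

lemma correlated_subset_distributions:
  "correlated_equilibria I S U \<subseteq> distributions_on (profiles I S)"
  by (auto simp: correlated_equilibria_def distributions_on_def)

text \<open>The gains \<open>?f t\<close> from switching to \<open>b\<close> are nonnegative by
  dominance, while the incentive constraint makes their sum at most 0. So each one vanishes, and at
  a key of \<open>\<mu>\<close> the weight can be cancelled.\<close>

lemma weakly_dominant_correlated:
  assumes "i \<in> I" "b \<in> S i"
    and dom: "\<And>s. s \<in> profiles I S \<Longrightarrow> U i s \<le> U i (s(i := b))"
    and \<mu>: "\<mu> \<in> correlated_equilibria I S U" "s \<in> Poly_Mapping.keys \<mu>"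
  shows "U i (s(i := b)) = U i s"
proof -
  have s: "s \<in> profiles I S"
    using \<mu> by (auto simp: correlated_equilibria_def)
  then have a: "s i \<in> S i"
    using assms(1) by (auto simp: profiles_def)
  let ?A = "{t. t \<in> profiles I S \<and> t i = s i}"
  let ?f = "\<lambda>t. Poly_Mapping.lookup \<mu> t * (U i (t(i := b)) - U i t)"
  have fin: "finite ?A"
    using finite_profiles by simp
  have "(\<Sum>t\<in>?A. ?f t) = - (\<Sum>t\<in>?A. Poly_Mapping.lookup \<mu> t * (U i t - U i (t(i := b))))"
    by (simp add: algebra_simps sum_subtractf)
  also have "\<dots> \<le> 0"
    using \<mu>(1) assms(1,2) a unfolding correlated_equilibria_iff by auto
  finally have le: "(\<Sum>t\<in>?A. ?f t) \<le> 0" .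
  have nn: "0 \<le> ?f t" if "t \<in> ?A" for t
    using that dom distributions_on_nonneg[OF subsetD[OF correlated_subset_distributions \<mu>(1)]]
    by simp
  have "?f s = 0"
    using le nn sum_nonneg[of ?A ?f] sum_nonneg_eq_0_iff[OF fin, of ?f] s by auto
  then show ?thesis
    using \<mu>(2) by (simp add: in_keys_iff)
qed

definition pure_equilibria :: "('i \<Rightarrow> ('i \<Rightarrow> 'a) \<Rightarrow> real) \<Rightarrow> ('i \<Rightarrow> 'a) set" where
  "pure_equilibria U = {s \<in> profiles I S. \<forall>i\<in>I. \<forall>b\<in>S i. U i (s(i := b)) \<le> U i s}"

text \<open>Each incentive constraint holds term by term, since every profile with positive weight
  is itself an equilibrium.\<close>

lemma distributions_on_pure_equilibria:
  assumes "F \<subseteq> pure_equilibria U"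
  shows "distributions_on F \<subseteq> correlated_equilibria I S U"
proof
  fix \<mu> assume \<mu>: "\<mu> \<in> distributions_on F"
  have "F \<subseteq> profiles I S"
    using assms by (auto simp: pure_equilibria_def)
  then have d: "\<mu> \<in> distributions_on (profiles I S)" and k: "Poly_Mapping.keys \<mu> \<subseteq> F"
    using distributions_on_subset_iff[OF finite_profiles] \<mu> by blast+
  have "0 \<le> Poly_Mapping.lookup \<mu> s * (U i s - U i (s(i := b)))"
    if "i \<in> I" "b \<in> S i" for s i b
  proof (cases "s \<in> F")
    case True
    then show ?thesis
      using assms that distributions_on_nonneg[OF d, of s] by (auto simp: pure_equilibria_def)
  next
    case False
    then have "Poly_Mapping.lookup \<mu> s = 0"
      using k by (auto simp: in_keys_iff)
    then show ?thesis
      by simp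
  qed
  then show "\<mu> \<in> correlated_equilibria I S U"
    using d unfolding correlated_equilibria_iff distributions_on_def by (auto intro!: sum_nonneg)
qed

section \<open>Games whose Nash equilibria are all pure\<close>

definition pure_profile :: "('i \<Rightarrow> 'a) \<Rightarrow> 'i \<Rightarrow> 'a \<Rightarrow> real" where
  "pure_profile s = (\<lambda>i\<in>I. pure_strategy (S i) (s i))"

lemma pure_profile_mixed:
  assumes "s \<in> profiles I S"
  shows "pure_profile s \<in> Pi\<^sub>E I (\<lambda>i. mixed_strategies (S i))"
  using assms finite_strategies
  by (auto simp: pure_profile_def profiles_def intro!: pure_strategy_mixed)

lemma inj_on_pure_profile: "inj_on pure_profile (profiles I S)"
proof (rule inj_onI)
  fix s t assume s: "s \<in> profiles I S" and t: "t \<in> profiles I S"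
    and eq: "pure_profile s = pure_profile t"
  show "s = t"
  proof (rule PiE_ext[of s I S t])
    fix i assume i: "i \<in> I"
    then have "pure_strategy (S i) (s i) (s i) = pure_strategy (S i) (t i) (s i)"
      using fun_cong[OF eq, of i] by (simp add: pure_profile_def)
    moreover have "s i \<in> S i"
      using s i by (auto simp: profiles_def)
    ultimately show "s i = t i"
      by (auto simp: pure_strategy_def split: if_splits)
  qed (use s t in \<open>auto simp: profiles_def\<close>)
qed

lemma product_distribution_pure_profile:
  assumes s: "s \<in> profiles I S"
  shows "product_distribution (pure_profile s) = Poly_Mapping.single s 1"
proof (rule poly_mapping_eqI)
  fix t
  have "(\<Prod>j\<in>I. pure_profile s j (t j)) = (if t = s then 1 else 0)" if t: "t \<in> profiles I S"
  proof -
    have "(\<Prod>j\<in>I. pure_profile s j (t j)) = (\<Prod>j\<in>I. of_bool (t j = s j))"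
      using s t by (intro prod.cong) (auto simp: pure_profile_def pure_strategy_def profiles_def)
    also have "\<dots> = (if t = s then 1 else 0)"
    proof (cases "t = s")
      case False
      then obtain j where "j \<in> I" "t j \<noteq> s j"
        using s t PiE_ext[of t I S s] by (auto simp: profiles_def)
      then show ?thesis
        using finite_players False by (auto intro!: prod_zero)
    qed simp
    finally show ?thesis .
  qed
  then show "Poly_Mapping.lookup (product_distribution (pure_profile s)) t =
      Poly_Mapping.lookup (Poly_Mapping.single s 1) t"
    using s by (auto simp: lookup_product_distribution lookup_single_if)
qed

lemma mixed_support_nonempty:
  assumes "p \<in> mixed_strategies A"
  obtains a where "a \<in> A" "0 < p a"
proof -
  have "\<exists>a\<in>A. p a \<noteq> 0"
    using assms by (force simp: mixed_strategies_def intro: ccontr)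
  then show ?thesis
    using assms that by (force simp: mixed_strategies_def less_le)
qed

text \<open>The support of a product distribution is a rectangle, and by \<open>isolated\<close> the only rectangles
  inside \<open>F\<close> are its points.\<close>

lemma nash_equilibria_isolated:
  assumes CE: "correlated_equilibria I S U = distributions_on F"
    and F: "F \<subseteq> profiles I S"
    and isolated: "\<And>s i a. s \<in> F \<Longrightarrow> i \<in> I \<Longrightarrow> s(i := a) \<in> F \<Longrightarrow> a = s i"
  shows "nash_equilibria I S U = pure_profile ` F"
proof (intro equalityI subsetI)
  fix x assume "x \<in> pure_profile ` F"
  then obtain s where s: "s \<in> F" "x = pure_profile s"
    by blast
  have "finite F"
    using F finite_profiles finite_subset by blast
  then have "product_distribution x \<in> correlated_equilibria I S U"
    using s F by (auto simp: product_distribution_pure_profile CE single_in_distributions_on)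
  then show "x \<in> nash_equilibria I S U"
    using s F nash_iff_product_correlated pure_profile_mixed by blast
next
  fix x assume x: "x \<in> nash_equilibria I S U"
  then have mix: "x \<in> Pi\<^sub>E I (\<lambda>i. mixed_strategies (S i))"
    by (simp add: nash_equilibria_def)
  have keys: "Poly_Mapping.keys (product_distribution x) \<subseteq> F"
    using x nash_iff_product_correlated[OF mix] by (auto simp: CE distributions_on_def)
  \<comment> \<open>A profile whose entries all have positive probability has positive product
    weight, so it is a key.\<close>
  have supp: "s \<in> F" if "s \<in> profiles I S" "\<And>j. j \<in> I \<Longrightarrow> 0 < x j (s j)" for s
  proof -
    have "0 < (\<Prod>j\<in>I. x j (s j))"
      using that(2) by (rule prod_pos)
    then show ?thesis
      using that(1) keys by (force simp: in_keys_iff lookup_product_distribution)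
  qed
  have "\<exists>a. a \<in> S i \<and> 0 < x i a" if "i \<in> I" for i
    using mixed_support_nonempty[of "x i" "S i"] mix that by blast
  then obtain f where f: "\<And>i. i \<in> I \<Longrightarrow> f i \<in> S i \<and> 0 < x i (f i)"
    by metis
  define s where "s = restrict f I"
  have s: "s \<in> profiles I S" "\<And>j. j \<in> I \<Longrightarrow> 0 < x j (s j)"
    using f by (auto simp: s_def profiles_def)
  \<comment> \<open>A second strategy of positive probability would put both \<open>s\<close> and
    \<open>s(i := a)\<close> into \<open>F\<close>.\<close>
  have zero: "x i a = 0" if i: "i \<in> I" and a: "a \<in> S i" "a \<noteq> s i" for i a
  proof (rule ccontr)
    assume "x i a \<noteq> 0"
    moreover have "0 \<le> x i a"
      using mix i a by (auto simp: mixed_strategies_def PiE_def Pi_def)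
    ultimately have "s(i := a) \<in> F"
      using s i a by (intro supp profiles_upd) auto
    then show False
      using isolated[OF supp[OF s] i] a by auto
  qed
  have "x = pure_profile s"
  proof (rule PiE_ext[OF mix pure_profile_mixed[OF s(1)]])
    fix i assume i: "i \<in> I"
    have xi: "x i \<in> mixed_strategies (S i)"
      using mix i by auto
    have si: "s i \<in> S i"
      using s(1) i by (auto simp: profiles_def)
    have "(\<Sum>a\<in>S i. x i a) = x i (s i)"
      using zero[OF i] si finite_strategies[OF i]
      by (subst sum.remove[of _ "s i"]) (auto intro!: sum.neutral)
    then have "x i (s i) = 1"
      using xi by (simp add: mixed_strategies_def)
    then have "x i a = pure_strategy (S i) (s i) a" for a
      using zero[OF i, of a] xi
      by (cases "a \<in> S i") (auto simp: pure_strategy_def mixed_strategies_def PiE_def extensional_def)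
    then show "x i = pure_profile s i"
      using i by (auto simp: pure_profile_def)
  qed
  then show "x \<in> pure_profile ` F"
    using supp[OF s] by blast
qed

text \<open>The Nash equilibria correspond to the points of \<open>F\<close>, and so do the extreme
  points, these being the vertices of the simplex over \<open>F\<close>.\<close>

lemma exactly_card_isolated:
  assumes CE: "correlated_equilibria I S U = distributions_on F"
    and F: "F \<subseteq> profiles I S"
    and isolated: "\<And>s i a. s \<in> F \<Longrightarrow> i \<in> I \<Longrightarrow> s(i := a) \<in> F \<Longrightarrow> a = s i"
  shows "exactly (card F) (nash_equilibria I S U)"
    and "exactly (card F) (correlated_extreme_points I S U)"
proof -
  have fin: "finite F"
    using F finite_profiles finite_subset by blast
  show "exactly (card F) (nash_equilibria I S U)"
    using fin card_image[OF inj_on_subset[OF inj_on_pure_profile F]]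
    using nash_equilibria_isolated[of U F] assms by (simp add: exactly_def)
  have "inj_on (\<lambda>s. Poly_Mapping.single s (1::real)) F"
    by (rule inj_onI) (metis lookup_single_if zero_neq_one)
  then show "exactly (card F) (correlated_extreme_points I S U)"
    using fin
    by (simp add: exactly_def correlated_extreme_points_def CE extreme_points_distributions_on card_image)
qed

end

section \<open>A family of degenerate games\<close>

text \<open>Convergence of each payoff is convergence in the product topology, so an open set
  containing \<open>U\<close> would contain \<open>V t\<close> for all small
  \<open>t > 0\<close>.\<close>

lemma not_open_propertyI:
  assumes "U \<in> topspace (game_space {1..n} (strategy_sets m))" "P U"
    and V: "\<And>t. 0 < t \<Longrightarrow> V t \<in> topspace (game_space {1..n} (strategy_sets m))"
    and "\<And>t. 0 < t \<Longrightarrow> \<not> P (V t)"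
    and lim: "\<And>i s. i \<in> {1..n} \<Longrightarrow> s \<in> profiles {1..n} (strategy_sets m) \<Longrightarrow>
        ((\<lambda>t::real. V t i s) \<longlongrightarrow> U i s) (at_right 0)"
  shows "\<not> open_property n m P"
proof
  let ?G = "game_space {1..n} (strategy_sets m)"
  have pos: "\<forall>\<^sub>F t in at_right 0. (0::real) < t"
    by (simp add: eventually_at_right_less)
  have "limitin ?G V U (at_right 0)"
    unfolding game_space_def limitin_componentwise
  proof (intro conjI ballI)
    show "U \<in> extensional {1..n}"
      using assms(1) by (auto simp: game_space_def PiE_def)
    show "\<forall>\<^sub>F t in at_right 0. V t \<in> topspace (product_topology
        (\<lambda>i. product_topology (\<lambda>s. euclideanreal) (profiles {1..n} (strategy_sets m))) {1..n})"
      using pos V[unfolded game_space_def] by (rule eventually_mono)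
    fix i assume i: "i \<in> {1..n}"
    show "U i \<in> extensional (profiles {1..n} (strategy_sets m))"
      using assms(1) i by (auto simp: game_space_def PiE_def Pi_def)
    show "\<forall>\<^sub>F t in at_right 0. V t i \<in> topspace
        (product_topology (\<lambda>s. euclideanreal) (profiles {1..n} (strategy_sets m)))"
      using pos
    proof (rule eventually_mono)
      fix t :: real assume "0 < t"
      then show "V t i \<in> topspace
          (product_topology (\<lambda>s. euclideanreal) (profiles {1..n} (strategy_sets m)))"
        using V[of t] i by (auto simp: game_space_def PiE_def Pi_def)
    qed
    fix s assume "s \<in> profiles {1..n} (strategy_sets m)"
    then show "limitin euclideanreal (\<lambda>t. V t i s) (U i s) (at_right 0)"
      using lim[OF i] by simp
  qed
  moreover assume "open_property n m P"
  ultimately have "\<forall>\<^sub>F t in at_right 0. V t \<in> {U \<in> topspace ?G. P U}"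
    using assms(1,2) unfolding limitin_def open_property_def by blast
  \<comment> \<open>The filter \<open>at_right 0\<close> is nontrivial, so nothing false holds
    eventually.\<close>
  then have "\<forall>\<^sub>F t in at_right (0::real). False"
    using pos by eventually_elim (use assms(4) in auto)
  then show False
    by simp
qed

locale ladder =
  fixes n k :: nat
  assumes n: "2 \<le> n" and k: "2 \<le> k"
begin

text \<open>Keeps \<open>1\<close> from becoming \<open>Suc 0\<close>, so that rules stated for
  player \<open>1\<close> or strategy \<open>1\<close> still match.\<close>

declare One_nat_def [simp del]

section \<open>The game and the coordinates of its profiles\<close>

definition shape :: "nat \<Rightarrow> nat" where
  "shape i = (if i \<le> 2 then k else 1)"

abbreviation strategies :: "nat \<Rightarrow> nat set" where
  "strategies \<equiv> strategy_sets shape"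

abbreviation profs :: "(nat \<Rightarrow> nat) set" where
  "profs \<equiv> profiles {1..n} strategies"

sublocale finite_game "{1..n}" strategies
  by unfold_locales (auto simp: strategy_sets_def)

lemma game_size_shape: "game_size n shape"
  using k by (auto simp: game_size_def shape_def)

definition payoff :: "real \<Rightarrow> real \<Rightarrow> nat \<Rightarrow> (nat \<Rightarrow> nat) \<Rightarrow> real" where
  "payoff \<epsilon> \<eta> i s =
     (if i = 1 then of_bool (s 1 \<le> s 2) + \<epsilon> * of_bool (s 1 = 1)
      else if i = 2 then of_bool (s 2 \<le> s 1) + \<epsilon> * of_bool (s 2 = 1) + \<eta> * of_bool (s 1 = k \<and> s 2 = k)
      else 0)"

definition game :: "real \<Rightarrow> real \<Rightarrow> nat \<Rightarrow> (nat \<Rightarrow> nat) \<Rightarrow> real" where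
  "game \<epsilon> \<eta> = (\<lambda>i\<in>{1..n}. \<lambda>s\<in>profs. payoff \<epsilon> \<eta> i s)"

lemma game_eq: "i \<in> {1..n} \<Longrightarrow> s \<in> profs \<Longrightarrow> game \<epsilon> \<eta> i s = payoff \<epsilon> \<eta> i s"
  by (simp add: game_def)

lemma game_topspace: "game \<epsilon> \<eta> \<in> topspace (game_space {1..n} strategies)"
  by (auto simp: game_space_def game_def)

lemma players: "1 \<in> {1..n}" "2 \<in> {1..n}"
  using n by auto

lemma strategies_12 [simp]: "strategies 1 = {1..k}" "strategies 2 = {1..k}"
  by (auto simp: strategy_sets_def shape_def)

lemma profs_12:
  assumes "s \<in> profs"
  shows "1 \<le> s 1" "s 1 \<le> k" "1 \<le> s 2" "s 2 \<le> k"
proof -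
  have "s 1 \<in> strategies 1" "s 2 \<in> strategies 2"
    using assms players unfolding profiles_def by blast+
  then show "1 \<le> s 1" "s 1 \<le> k" "1 \<le> s 2" "s 2 \<le> k"
    by auto
qed

text \<open>From the third player on, 1 is the only strategy, so the first two entries determine a
  profile.\<close>

definition profile :: "nat \<Rightarrow> nat \<Rightarrow> nat \<Rightarrow> nat" where
  "profile a b = (\<lambda>i\<in>{1..n}. if i = 1 then a else if i = 2 then b else 1)"

lemma profile_12 [simp]: "profile a b 1 = a" "profile a b 2 = b"
  using n by (auto simp: profile_def)

lemma profile_in_profs:
  assumes "a \<in> {1..k}" "b \<in> {1..k}"
  shows "profile a b \<in> profs"
  using assms by (auto simp: profile_def profiles_def strategy_sets_def shape_def)

lemma profile_eq:
  assumes "s \<in> profs"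
  shows "profile (s 1) (s 2) = s"
proof
  fix i
  have "s i \<in> strategies i" if "i \<in> {1..n}"
    using assms that unfolding profiles_def by blast
  moreover have "s i = undefined" if "i \<notin> {1..n}"
    using assms that by (auto simp: profiles_def PiE_def extensional_def)
  ultimately show "profile (s 1) (s 2) i = s i"
    by (auto simp: profile_def strategy_sets_def shape_def)
qed

section \<open>Equilibria of the base game and under the bonus \<epsilon>\<close>

definition diagonal :: "(nat \<Rightarrow> nat) set" where
  "diagonal = {s \<in> profs. s 1 = s 2}"

lemma card_diagonal: "card diagonal = k"
proof -
  have "diagonal = (\<lambda>a. profile a a) ` {1..k}"
  proof (intro equalityI subsetI)
    fix s assume "s \<in> diagonal"
    then show "s \<in> (\<lambda>a. profile a a) ` {1..k}"
      using profile_eq[of s] profs_12[of s] by (intro image_eqI[of _ _ "s 1"]) (auto simp: diagonal_def)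
  qed (auto simp: diagonal_def profile_in_profs)
  moreover have "inj_on (\<lambda>a. profile a a) {1..k}"
    by (rule inj_onI) (metis profile_12(1))
  ultimately show ?thesis
    by (simp add: card_image)
qed

text \<open>On the diagonal both players already obtain the 1 from the comparison. Player 2 cannot
  reach the bonus \<eta> alone from another diagonal profile, because player 1 is not at
  \<open>k\<close> there.\<close>

lemma diagonal_pure_equilibria:
  assumes "0 \<le> \<eta>"
  shows "diagonal \<subseteq> pure_equilibria (game 0 \<eta>)"
  using assms
  by (auto simp: diagonal_def pure_equilibria_def game_eq profiles_upd payoff_def)

text \<open>As 1 is the least strategy, it wins the comparison against every strategy of the
  opponent.\<close>

lemma one_weakly_dominant:
  assumes "0 \<le> \<epsilon>" "s \<in> profs" "i \<in> {1, 2}"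
  shows "game \<epsilon> 0 i s \<le> game \<epsilon> 0 i (s(i := 1))"
  using assms players k profs_12[OF assms(2)]
  by (auto simp: game_eq profiles_upd payoff_def)

text \<open>Switching to 1 always yields \<open>1 + \<epsilon>\<close>. Dominance leaves no gain
  from it on the support, so both comparisons hold there already and, for
  \<open>\<epsilon> > 0\<close>, the bonus is already collected.\<close>

lemma correlated_support:
  assumes "0 \<le> \<epsilon>" "\<mu> \<in> correlated_equilibria {1..n} strategies (game \<epsilon> 0)"
    and "s \<in> Poly_Mapping.keys \<mu>"
  shows "s \<in> profs" "s 1 = s 2" "0 < \<epsilon> \<Longrightarrow> s 1 = 1"
proof -
  show s: "s \<in> profs"
    using assms by (auto simp: correlated_equilibria_def)
  have "game \<epsilon> 0 i (s(i := 1)) = game \<epsilon> 0 i s" if "i \<in> {1, 2}" for i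
    using that players k assms
    by (intro weakly_dominant_correlated[of i 1] one_weakly_dominant) auto
  from this[of 1] this[of 2]
  have *: "of_bool (s 1 \<le> s 2) + \<epsilon> * of_bool (s 1 = 1) = 1 + \<epsilon>"
    "of_bool (s 2 \<le> s 1) + \<epsilon> * of_bool (s 2 = 1) = 1 + \<epsilon>"
    using s players k profs_12[OF s] by (auto simp: game_eq profiles_upd payoff_def)
  then show "s 1 = s 2" "0 < \<epsilon> \<Longrightarrow> s 1 = 1"
    using assms(1) by (auto simp: of_bool_def split: if_splits)
qed

lemma correlated_base:
  "correlated_equilibria {1..n} strategies (game 0 0) = distributions_on diagonal"
proof
  show "correlated_equilibria {1..n} strategies (game 0 0) \<subseteq> distributions_on diagonal"
    using correlated_support[of 0] correlated_subset_distributions[of "game 0 0"]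
    by (subst subset_iff, subst distributions_on_subset_iff[OF finite_profiles])
      (auto simp: diagonal_def)
  show "distributions_on diagonal \<subseteq> correlated_equilibria {1..n} strategies (game 0 0)"
    by (intro distributions_on_pure_equilibria diagonal_pure_equilibria) simp
qed

lemma profile_11: "profile 1 1 \<in> profs"
  using k by (simp add: profile_in_profs)

lemma correlated_dominant:
  assumes "0 < \<epsilon>"
  shows "correlated_equilibria {1..n} strategies (game \<epsilon> 0) = distributions_on {profile 1 1}"
proof
  have "s = profile 1 1"
    if "\<mu> \<in> correlated_equilibria {1..n} strategies (game \<epsilon> 0)" "s \<in> Poly_Mapping.keys \<mu>" for \<mu> s
    using correlated_support[OF _ that] profile_eq[of s] assms by simp
  then show "correlated_equilibria {1..n} strategies (game \<epsilon> 0) \<subseteq> distributions_on {profile 1 1}"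
    using correlated_subset_distributions profile_11
    by (subst subset_iff, subst distributions_on_subset_iff[OF finite_profiles]) auto
  show "distributions_on {profile 1 1} \<subseteq> correlated_equilibria {1..n} strategies (game \<epsilon> 0)"
    using assms profile_11 k
    by (intro distributions_on_pure_equilibria)
      (auto simp: pure_equilibria_def game_eq profiles_upd payoff_def)
qed

lemma base_count:
  "exactly k (nash_equilibria {1..n} strategies (game 0 0))"
  "exactly k (correlated_extreme_points {1..n} strategies (game 0 0))"
proof -
  have isolated: "a = s i" if "s \<in> diagonal" "i \<in> {1..n}" "s(i := a) \<in> diagonal" for s i a
  proof -
    have "s(i := a) \<in> profs" "(s(i := a)) 1 = (s(i := a)) 2" "s \<in> profs" "s 1 = s 2"
      using that by (auto simp: diagonal_def)
    \<comment> \<open>For later players the update leaves the first two entries alone, and these fix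
      the whole profile.\<close>
    moreover have "(s(i := a)) i = s i" if "i \<notin> {1, 2}"
      using profile_eq[of s] profile_eq[of "s(i := a)"] that calculation
      by (metis fun_upd_other insertCI)
    ultimately show ?thesis
      by (cases "i \<in> {1, 2}") auto
  qed
  have "diagonal \<subseteq> profs"
    by (auto simp: diagonal_def)
  note count = exactly_card_isolated[OF correlated_base this, unfolded card_diagonal]
  show "exactly k (nash_equilibria {1..n} strategies (game 0 0))"
    by (rule count(1)) (rule isolated)
  show "exactly k (correlated_extreme_points {1..n} strategies (game 0 0))"
    by (rule count(2)) (rule isolated)
qed

lemma dominant_count:
  assumes "0 < \<epsilon>"
  shows "exactly 1 (nash_equilibria {1..n} strategies (game \<epsilon> 0))"
    and "exactly 1 (correlated_extreme_points {1..n} strategies (game \<epsilon> 0))"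
proof -
  have "a = s i" if "s \<in> {profile 1 1}" "s(i := a) \<in> {profile 1 1}" for s i a
    using that by (metis fun_upd_same singletonD)
  then show "exactly 1 (nash_equilibria {1..n} strategies (game \<epsilon> 0))"
      "exactly 1 (correlated_extreme_points {1..n} strategies (game \<epsilon> 0))"
    using exactly_card_isolated[OF correlated_dominant[OF assms]] profile_11
    by (simp_all add: One_nat_def)
qed

section \<open>The bonus \<eta>: distributions on two profiles\<close>

lemma sum_two_keys:
  assumes "finite A" "P \<in> A" "Q \<in> A" "P \<noteq> Q" "Poly_Mapping.keys \<mu> \<subseteq> {P, Q}"
  shows "(\<Sum>s\<in>A. Poly_Mapping.lookup \<mu> s * g s) =
    Poly_Mapping.lookup \<mu> P * g P + Poly_Mapping.lookup \<mu> Q * (g Q :: real)"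
proof -
  have "(\<Sum>s\<in>A. Poly_Mapping.lookup \<mu> s * g s) = (\<Sum>s\<in>{P, Q}. Poly_Mapping.lookup \<mu> s * g s)"
    using assms by (intro sum.mono_neutral_right) (auto simp: in_keys_iff)
  then show ?thesis
    using assms(4) by simp
qed

text \<open>Player 2 plays \<open>k\<close> in both profiles; \<open>P\<close> and \<open>Q\<close>
  are the ends of the segment along which player 1 shifts weight from \<open>k\<close> to 1.\<close>

abbreviation "P \<equiv> profile 1 k"
abbreviation "Q \<equiv> profile k k"

lemma PQ: "P \<in> profs" "Q \<in> profs" "P \<noteq> Q"
proof -
  show "P \<in> profs" "Q \<in> profs"
    using k by (auto intro: profile_in_profs)
  show "P \<noteq> Q"
    using k profile_12(1)[of 1 k] profile_12(1)[of k k] by force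
qed

text \<open>Leaving \<open>k\<close> costs player 2 the bonus \<eta> at \<open>Q\<close>. At
  \<open>P\<close> player 2 gets 0, and only the deviation to 1 gains there, namely 1.\<close>

lemma sum_incentive_PQ:
  assumes \<mu>: "Poly_Mapping.keys \<mu> \<subseteq> {P, Q}" and b: "b \<in> {1..k}"
  shows "(\<Sum>s | s \<in> profs \<and> s 2 = k. Poly_Mapping.lookup \<mu> s *
            (game 0 \<eta> 2 s - game 0 \<eta> 2 (s(2 := b)))) =
         (if b = k then 0 else \<eta> * Poly_Mapping.lookup \<mu> Q -
            (if b = 1 then Poly_Mapping.lookup \<mu> P else 0))"
proof -
  have "(\<Sum>s | s \<in> profs \<and> s 2 = k. Poly_Mapping.lookup \<mu> s *
            (game 0 \<eta> 2 s - game 0 \<eta> 2 (s(2 := b)))) =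
      Poly_Mapping.lookup \<mu> P * (game 0 \<eta> 2 P - game 0 \<eta> 2 (P(2 := b))) +
      Poly_Mapping.lookup \<mu> Q * (game 0 \<eta> 2 Q - game 0 \<eta> 2 (Q(2 := b)))"
    using PQ finite_profiles \<mu> by (intro sum_two_keys) auto
  moreover have "P(2 := b) \<in> profs" "Q(2 := b) \<in> profs"
    using PQ players b by (auto intro!: profiles_upd)
  ultimately show ?thesis
    using PQ players k b by (auto simp: game_eq payoff_def)
qed

text \<open>The first bound is player 2's constraint against moving from \<open>k\<close> to 1; the
  second is the total mass.\<close>

lemma correlated_PQ_bound:
  assumes \<mu>: "\<mu> \<in> correlated_equilibria {1..n} strategies (game 0 \<eta>)"
    and keys: "Poly_Mapping.keys \<mu> \<subseteq> {P, Q}"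
  shows "Poly_Mapping.lookup \<mu> P \<le> \<eta> * Poly_Mapping.lookup \<mu> Q"
    and "Poly_Mapping.lookup \<mu> P + Poly_Mapping.lookup \<mu> Q = 1"
proof -
  have "k \<in> strategies 2" "1 \<in> strategies 2"
    using k by auto
  then have "0 \<le> (\<Sum>s | s \<in> profs \<and> s 2 = k. Poly_Mapping.lookup \<mu> s *
            (game 0 \<eta> 2 s - game 0 \<eta> 2 (s(2 := 1))))"
    using \<mu> players(2) unfolding correlated_equilibria_iff by blast
  then show "Poly_Mapping.lookup \<mu> P \<le> \<eta> * Poly_Mapping.lookup \<mu> Q"
    using sum_incentive_PQ[OF keys, of 1 \<eta>] k by simp
  have "(\<Sum>s\<in>profs. Poly_Mapping.lookup \<mu> s * 1) = 1"
    using \<mu> by (simp add: correlated_equilibria_def)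
  then show "Poly_Mapping.lookup \<mu> P + Poly_Mapping.lookup \<mu> Q = 1"
    using sum_two_keys[OF finite_profiles PQ keys, of "\<lambda>_. 1"] by simp
qed

definition mixture :: "real \<Rightarrow> ((nat \<Rightarrow> nat) \<Rightarrow>\<^sub>0 real)" where
  "mixture t = t *\<^sub>R Poly_Mapping.single P 1 + (1 - t) *\<^sub>R Poly_Mapping.single Q 1"

lemma lookup_mixture:
  "Poly_Mapping.lookup (mixture t) s = (if s = P then t else if s = Q then 1 - t else 0)"
  using PQ(3) by (simp add: mixture_def lookup_add lookup_single_if)

lemma keys_mixture: "Poly_Mapping.keys (mixture t) \<subseteq> {P, Q}"
  by (auto simp: in_keys_iff lookup_mixture split: if_splits)

text \<open>The only conflict is player 2's at recommendation \<open>k\<close>, and the third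
  hypothesis settles it; all other constraints hold term by term.\<close>

lemma mixture_correlated:
  assumes t: "0 \<le> t" "t \<le> 1" "t \<le> \<eta> * (1 - t)"
  shows "mixture t \<in> correlated_equilibria {1..n} strategies (game 0 \<eta>)"
  unfolding correlated_equilibria_iff
proof (intro conjI ballI)
  show "Poly_Mapping.keys (mixture t) \<subseteq> profs"
    using keys_mixture PQ by blast
  have nonneg: "0 \<le> Poly_Mapping.lookup (mixture t) s" for s
    using t by (simp add: lookup_mixture)
  then show "0 \<le> Poly_Mapping.lookup (mixture t) s" for s .
  have "(\<Sum>s\<in>profs. Poly_Mapping.lookup (mixture t) s * 1) = 1"
    using PQ by (subst sum_two_keys[OF finite_profiles PQ keys_mixture]) (simp add: lookup_mixture)
  then show "(\<Sum>s\<in>profs. Poly_Mapping.lookup (mixture t) s) = 1"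
    by simp
  fix i a b assume i: "i \<in> {1..n}" and "a \<in> strategies i" and b: "b \<in> strategies i"
  let ?f = "\<lambda>s. Poly_Mapping.lookup (mixture t) s * (game 0 \<eta> i s - game 0 \<eta> i (s(i := b)))"
  show "0 \<le> (\<Sum>s | s \<in> profs \<and> s i = a. ?f s)"
  proof (cases "i = 2 \<and> a = k")
    case True
    then have "(\<Sum>s | s \<in> profs \<and> s i = a. ?f s) = (if b = k then 0 else \<eta> * (1 - t) - (if b = 1 then t else 0))"
      using sum_incentive_PQ[OF keys_mixture, of b t \<eta>] b PQ(3) by (simp add: lookup_mixture)
    then show ?thesis
      using t by auto
  next
    case False
    have "0 \<le> ?f s" if s: "s \<in> profs" "s i = a" for s
    proof (cases "s \<in> {P, Q}")
      case True
      \<comment> \<open>Against \<open>k\<close> player 1 gets 1 from every strategy, and later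
        players get 0 throughout.\<close>
      then have "s 2 = k" "i \<noteq> 2"
        using False s by auto
      then have "game 0 \<eta> i (s(i := b)) \<le> game 0 \<eta> i s"
        using i b s profs_12[OF s(1)] by (auto simp: game_eq profiles_upd payoff_def)
      then show ?thesis
        using nonneg[of s] by simp
    qed (simp add: lookup_mixture)
    then show ?thesis
      by (auto intro: sum_nonneg)
  qed
qed

definition mixed_profile :: "real \<Rightarrow> nat \<Rightarrow> nat \<Rightarrow> real" where
  "mixed_profile t = (pure_profile Q)
     (1 := (\<lambda>a\<in>{1..k}. t * pure_strategy {1..k} 1 a + (1 - t) * pure_strategy {1..k} k a))"

lemma mixed_profile_mixed:
  assumes "0 \<le> t" "t \<le> 1"
  shows "mixed_profile t \<in> Pi\<^sub>E {1..n} (\<lambda>i. mixed_strategies (strategies i))"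
proof -
  have pure: "pure_strategy {1..k} 1 \<in> mixed_strategies {1..k}"
      "pure_strategy {1..k} k \<in> mixed_strategies {1..k}"
    using k by (auto intro: pure_strategy_mixed)
  have "(\<lambda>a\<in>{1..k}. t * pure_strategy {1..k} 1 a + (1 - t) * pure_strategy {1..k} k a)
      \<in> mixed_strategies {1..k}"
    using pure assms
    by (auto simp: mixed_strategies_def sum.distrib PiE_def Pi_def simp flip: sum_distrib_left)
  then show ?thesis
    using pure_profile_mixed[OF PQ(2)] players
    by (auto simp: mixed_profile_def PiE_def Pi_def extensional_def)
qed

text \<open>\<open>P\<close> and \<open>Q\<close> differ only in the entry of player 1, so the other
  players contribute a common factor \<open>?R\<close>, and player 1's factor is linear in the two
  pure strategies.\<close>

lemma product_distribution_mixed_profile: "product_distribution (mixed_profile t) = mixture t"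
proof (rule poly_mapping_eqI)
  fix s
  let ?R = "\<Prod>j\<in>{1..n} - {1}. pure_profile Q j (s j)"
  show "Poly_Mapping.lookup (product_distribution (mixed_profile t)) s = Poly_Mapping.lookup (mixture t) s"
  proof (cases "s \<in> profs")
    case True
    have P': "Poly_Mapping.lookup (Poly_Mapping.single P 1) s = pure_strategy {1..k} 1 (s 1) * ?R"
    proof -
      have "(\<Prod>j\<in>{1..n} - {1}. pure_profile P j (s j)) = ?R"
        by (intro prod.cong) (auto simp: pure_profile_def profile_def)
      then show ?thesis
        using True players
        by (simp add: product_distribution_pure_profile[OF PQ(1), symmetric]
            lookup_product_distribution prod.remove[of _ 1] pure_profile_def)
    qed
    have Q': "Poly_Mapping.lookup (Poly_Mapping.single Q 1) s = pure_strategy {1..k} k (s 1) * ?R"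
      using True players
      by (simp add: product_distribution_pure_profile[OF PQ(2), symmetric]
          lookup_product_distribution prod.remove[of _ 1] pure_profile_def)
    have "(\<Prod>j\<in>{1..n} - {1}. mixed_profile t j (s j)) = ?R"
      by (intro prod.cong) (auto simp: mixed_profile_def)
    then have "Poly_Mapping.lookup (product_distribution (mixed_profile t)) s =
        (t * pure_strategy {1..k} 1 (s 1) + (1 - t) * pure_strategy {1..k} k (s 1)) * ?R"
      using True players profs_12[OF True]
      by (simp add: lookup_product_distribution prod.remove[of _ 1] mixed_profile_def)
    then show ?thesis
      unfolding mixture_def lookup_add lookup_scaleR P' Q' by (simp add: algebra_simps)
  next
    case False
    then show ?thesis
      using PQ by (auto simp: lookup_product_distribution lookup_mixture)
  qed
qed

lemma infinite_nash:
  assumes \<eta>: "0 < \<eta>"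
  shows "infinite (nash_equilibria {1..n} strategies (game 0 \<eta>))"
proof -
  \<comment> \<open>The right end solves \<open>t = \<eta> * (1 - t)\<close>, the limit set by
    \<open>mixture_correlated\<close>.\<close>
  let ?T = "{0..\<eta> / (1 + \<eta>)}"
  have "mixed_profile t \<in> nash_equilibria {1..n} strategies (game 0 \<eta>)" if "t \<in> ?T" for t
  proof -
    have "\<eta> / (1 + \<eta>) \<le> 1"
      using \<eta> by (simp add: field_simps)
    then have "t \<le> 1"
      using that by (meson atLeastAtMost_iff order_trans)
    moreover have "0 \<le> t" "t \<le> \<eta> * (1 - t)"
      using that \<eta> by (auto simp: pos_le_divide_eq algebra_simps)
    ultimately show ?thesis
      using nash_iff_product_correlated[OF mixed_profile_mixed] mixture_correlated
      by (simp add: product_distribution_mixed_profile)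
  qed
  then have sub: "mixed_profile ` ?T \<subseteq> nash_equilibria {1..n} strategies (game 0 \<eta>)"
    by blast
  \<comment> \<open>The parameter is recovered as player 1's weight on strategy 1, which differs
    from \<open>k\<close> because \<open>k\<close> is at least 2.\<close>
  have "mixed_profile t 1 1 = t" for t
    using k by (simp add: mixed_profile_def pure_strategy_def)
  then have "inj_on mixed_profile ?T"
    by (intro inj_onI) metis
  moreover have "infinite ?T"
    using \<eta> by (simp add: infinite_Icc)
  ultimately show ?thesis
    using sub finite_imageD finite_subset by blast
qed

text \<open>\<open>mixture \<tau>\<close> has the largest weight on \<open>P\<close> among
  correlated equilibria supported in \<open>{P, Q}\<close>, and that weight determines such a
  distribution. Segments through it stay within this support, so it is extreme, in addition to the
  \<open>k\<close> point masses on the diagonal.\<close>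

lemma many_extreme_points:
  assumes \<eta>: "0 < \<eta>"
  shows "\<not> at_most k (correlated_extreme_points {1..n} strategies (game 0 \<eta>))"
proof
  let ?C = "correlated_equilibria {1..n} strategies (game 0 \<eta>)"
  define \<tau> where "\<tau> = \<eta> / (1 + \<eta>)"
  have \<tau>: "0 < \<tau>" "\<tau> < 1" "\<tau> = \<eta> * (1 - \<tau>)"
    using \<eta> by (auto simp: \<tau>_def field_simps)
  have le\<tau>: "Poly_Mapping.lookup a P \<le> \<tau>" if "a \<in> ?C" "Poly_Mapping.keys a \<subseteq> {P, Q}" for a
  proof -
    have "Poly_Mapping.lookup a P \<le> \<eta> * (1 - Poly_Mapping.lookup a P)"
      using correlated_PQ_bound[OF that] by (metis add_diff_cancel_left')
    then show ?thesis
      using \<eta> by (simp add: \<tau>_def pos_le_divide_eq algebra_simps)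
  qed
  have "mixture \<tau> \<notin> open_segment a b" if C: "a \<in> ?C" "b \<in> ?C" for a b
  proof
    assume seg: "mixture \<tau> \<in> open_segment a b"
    then obtain u where u: "a \<noteq> b" "0 < u" "u < 1" "mixture \<tau> = (1 - u) *\<^sub>R a + u *\<^sub>R b"
      by (auto simp: in_segment)
    have "a \<in> distributions_on profs" "b \<in> distributions_on profs"
      using C correlated_subset_distributions by blast+
    from keys_open_segment[OF seg this]
    have keys: "Poly_Mapping.keys a \<subseteq> {P, Q}" "Poly_Mapping.keys b \<subseteq> {P, Q}"
      using keys_mixture by blast+
    have eq: "\<tau> = (1 - u) * Poly_Mapping.lookup a P + u * Poly_Mapping.lookup b P"
      using arg_cong[OF u(4), of "\<lambda>\<mu>. Poly_Mapping.lookup \<mu> P"]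
      by (simp add: lookup_mixture lookup_add)
    \<comment> \<open>Both gaps are nonnegative by \<open>le\<tau>\<close> and have positive
      weights, so both are 0.\<close>
    have "(1 - u) * (\<tau> - Poly_Mapping.lookup a P) + u * (\<tau> - Poly_Mapping.lookup b P) = 0"
      using eq by (simp add: algebra_simps)
    then have eqP: "Poly_Mapping.lookup a P = \<tau>" "Poly_Mapping.lookup b P = \<tau>"
      using u le\<tau>[OF C(1) keys(1)] le\<tau>[OF C(2) keys(2)]
      by (simp_all add: add_nonneg_eq_0_iff)
    have "a = b"
    proof (rule poly_mapping_eqI)
      fix s
      show "Poly_Mapping.lookup a s = Poly_Mapping.lookup b s"
      proof (cases "s \<in> {P, Q}")
        case True
        then show ?thesis
          using eqP correlated_PQ_bound(2)[OF C(1) keys(1)] correlated_PQ_bound(2)[OF C(2) keys(2)]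
          by auto
      next
        case False
        then show ?thesis
          using keys by (metis in_keys_iff subsetD)
      qed
    qed
    then show False
      using u(1) by simp
  qed
  moreover have "mixture \<tau> \<in> ?C"
    using \<tau> by (intro mixture_correlated) auto
  ultimately have "mixture \<tau> \<in> correlated_extreme_points {1..n} strategies (game 0 \<eta>)"
    by (auto simp: correlated_extreme_points_def extreme_point_of_def)
  moreover have "Poly_Mapping.single s 1 \<in> correlated_extreme_points {1..n} strategies (game 0 \<eta>)"
    if "s \<in> diagonal" for s
  proof -
    have "{s} \<subseteq> pure_equilibria (game 0 \<eta>)"
      using diagonal_pure_equilibria[of \<eta>] \<eta> that by auto
    from distributions_on_pure_equilibria[OF this] have "Poly_Mapping.single s 1 \<in> ?C"
      by (simp add: distributions_on_singleton)
    then show ?thesis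
      unfolding correlated_extreme_points_def mem_Collect_eq
      by (rule single_extreme_point[OF finite_profiles correlated_subset_distributions])
  qed
  ultimately have sub: "insert (mixture \<tau>) ((\<lambda>s. Poly_Mapping.single s 1) ` diagonal)
      \<subseteq> correlated_extreme_points {1..n} strategies (game 0 \<eta>)"
    by blast
  have "finite diagonal"
    using finite_profiles by (simp add: diagonal_def)
  moreover have "inj_on (\<lambda>s. Poly_Mapping.single s (1::real)) diagonal"
    by (rule inj_onI) (metis lookup_single_if zero_neq_one)
  \<comment> \<open>Its weight at \<open>P\<close> lies strictly between 0 and 1.\<close>
  moreover have "mixture \<tau> \<noteq> Poly_Mapping.single s 1" for s
  proof
    assume "mixture \<tau> = Poly_Mapping.single s 1"
    then have "\<tau> = (if P = s then 1 else 0)"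
      by (metis lookup_mixture lookup_single_if)
    then show False
      using \<tau> by (auto split: if_splits)
  qed
  ultimately have "card (insert (mixture \<tau>) ((\<lambda>s. Poly_Mapping.single s 1) ` diagonal)) = Suc k"
    by (subst card_insert_disjoint) (auto simp: card_image card_diagonal)
  \<comment> \<open>The finiteness included in \<open>at_most\<close> is what allows cardinalities
    to be compared below.\<close>
  moreover assume "at_most k (correlated_extreme_points {1..n} strategies (game 0 \<eta>))"
  ultimately show False
    using card_mono[OF _ sub] by (simp add: at_most_def)
qed

section \<open>Failure of openness at the base game\<close>

lemma tendsto_game:
  assumes "i \<in> {1..n}" "s \<in> profs"
  shows "((\<lambda>t. game t 0 i s) \<longlongrightarrow> game 0 0 i s) (at_right 0)"
    and "((\<lambda>t. game 0 t i s) \<longlongrightarrow> game 0 0 i s) (at_right 0)"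
  using assms by (auto simp: game_eq payoff_def intro!: tendsto_eq_intros)

lemma not_open_dominant:
  assumes "Pr (game 0 0)" "\<And>\<epsilon>. 0 < \<epsilon> \<Longrightarrow> \<not> Pr (game \<epsilon> 0)"
  shows "\<not> open_property n shape Pr"
  by (rule not_open_propertyI[OF game_topspace, where V = "\<lambda>t. game t 0"])
    (use assms game_topspace tendsto_game in auto)

lemma not_open_mixture:
  assumes "Pr (game 0 0)" "\<And>\<eta>. 0 < \<eta> \<Longrightarrow> \<not> Pr (game 0 \<eta>)"
  shows "\<not> open_property n shape Pr"
  by (rule not_open_propertyI[OF game_topspace, where V = "\<lambda>t. game 0 t"])
    (use assms game_topspace tendsto_game in auto)

text \<open>Along \<epsilon> both counts drop from \<open>k\<close> to 1, which breaks "exactly" and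
  "at least" as \<open>k\<close> is at least 2. Along \<eta> both exceed \<open>k\<close>, which
  breaks "at most".\<close>

lemma not_open:
  "\<not> open_property n shape (\<lambda>U. exactly k (nash_equilibria {1..n} strategies U))"
  "\<not> open_property n shape (\<lambda>U. at_most k (nash_equilibria {1..n} strategies U))"
  "\<not> open_property n shape (\<lambda>U. at_least k (nash_equilibria {1..n} strategies U))"
  "\<not> open_property n shape (\<lambda>U. exactly k (correlated_extreme_points {1..n} strategies U))"
  "\<not> open_property n shape (\<lambda>U. at_most k (correlated_extreme_points {1..n} strategies U))"
  "\<not> open_property n shape (\<lambda>U. at_least k (correlated_extreme_points {1..n} strategies U))"
proof -
  show "\<not> open_property n shape (\<lambda>U. exactly k (nash_equilibria {1..n} strategies U))"
    "\<not> open_property n shape (\<lambda>U. at_least k (nash_equilibria {1..n} strategies U))"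
    using base_count(1) dominant_count(1) k
    by (intro not_open_dominant; force simp: exactly_def at_least_def)+
  show "\<not> open_property n shape (\<lambda>U. exactly k (correlated_extreme_points {1..n} strategies U))"
    "\<not> open_property n shape (\<lambda>U. at_least k (correlated_extreme_points {1..n} strategies U))"
    using base_count(2) dominant_count(2) k
    by (intro not_open_dominant; force simp: exactly_def at_least_def)+
  show "\<not> open_property n shape (\<lambda>U. at_most k (nash_equilibria {1..n} strategies U))"
    using base_count(1) infinite_nash
    by (intro not_open_mixture) (auto simp: exactly_def at_most_def)
  show "\<not> open_property n shape (\<lambda>U. at_most k (correlated_extreme_points {1..n} strategies U))"
    using base_count(2) many_extreme_points
    by (intro not_open_mixture) (auto simp: exactly_def at_most_def)
qed

end

theorem proposition9:
  fixes n k :: nat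
  assumes "2 \<le> n" and "2 \<le> k"
  shows "(\<exists>m. game_size n m \<and> \<not> open_property n m
           (\<lambda>U. exactly k (nash_equilibria {1..n} (strategy_sets m) U))) \<and>
         (\<exists>m. game_size n m \<and> \<not> open_property n m
           (\<lambda>U. at_most k (nash_equilibria {1..n} (strategy_sets m) U))) \<and>
         (\<exists>m. game_size n m \<and> \<not> open_property n m
           (\<lambda>U. at_least k (nash_equilibria {1..n} (strategy_sets m) U))) \<and>
         (\<exists>m. game_size n m \<and> \<not> open_property n m
           (\<lambda>U. exactly k (correlated_extreme_points {1..n} (strategy_sets m) U))) \<and>
         (\<exists>m. game_size n m \<and> \<not> open_property n m
           (\<lambda>U. at_most k (correlated_extreme_points {1..n} (strategy_sets m) U))) \<and>
         (\<exists>m. game_size n m \<and> \<not> open_property n m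
           (\<lambda>U. at_least k (correlated_extreme_points {1..n} (strategy_sets m) U)))"
proof -
  interpret ladder n k
    using assms by unfold_locales
  \<comment> \<open>The size \<open>shape\<close> is the witness for all six properties.\<close>
  show ?thesis
    using game_size_shape not_open by blast
qed

end
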